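(* Let $G$ and $H$ be graphs without isolated vertices. Then $$(G\times H)^{[\natural 2]}=(G^{[[2]]}\,\square\, H^{[[2]]} )\uplus (G^{[[2]]}\times H^{[\natural 2]} )\uplus (G^{[\natural 2]}\times H^{[[2]]})\,.$$ In particular, if $G$ and $H$ are triangle-free, then $$(G\times H)^{[\natural 2]}=G^{[\natural 2]}\boxtimes H^{[\natural 2]}\,.$$
   Context: For a graph $G$, $G^{[\natural 2]}$ is the graph on $V(G)$ in which two vertices are adjacent iff their distance in $G$ is exactly $2$. $G^{[[2]]}$ is the graph on $V(G)$ in which two vertices $x,y$ are adjacent iff they are connected in $G$ by a path of length $2$ (i.e. $x\neq y$ and they have a common neighbor). If two graphs have the same vertex set, $\uplus$ denotes the graph on that vertex set whose edge set is the union of the edge sets. All products have vertex set $V(G)\times V(H)$. Direct product $G\times H$: $(g_1,h_1)(g_2,h_2)$ is an edge iff $g_1g_2\in E(G)$ and $h_1h_2\in E(H)$. Cartesian product $G\,\square\,H$: edge iff either $g_1g_2\in E(G)$ and $h_1=h_2$, or $g_1=g_2$ and $h_1h_2\in E(H)$. Strong product $G\boxtimes H$: distinct vertices adjacent iff $g_1g_2\in E(G)$ and $h_1=h_2$, or $g_1=g_2$ and $h_1h_2\in E(H)$, or $g_1g_2\in E(G)$ and $h_1h_2\in E(H)$. Equalities are equalities of graphs on $V(G)\times V(H)$. *)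

theory Defs
  imports "Graph_Theory.Pair_Digraph" "Graph_Theory.Shortest_Path"
begin

text \<open>
  Graphs are simple undirected graphs, possibly infinite: an undirected edge is a pair of
  opposite arcs, and the graph has no loops.
\<close>

abbreviation simple_graph :: "'a pair_pre_digraph \<Rightarrow> bool" where
  "simple_graph G \<equiv> pair_bidirected_digraph G"

definition isolated_vertex :: "'a pair_pre_digraph \<Rightarrow> 'a \<Rightarrow> bool" where
  "isolated_vertex G v \<longleftrightarrow> v \<in> pverts G \<and> \<not> (\<exists>u. (v, u) \<in> parcs G)"

definition triangle_free :: "'a pair_pre_digraph \<Rightarrow> bool" where
  "triangle_free G \<longleftrightarrow>
     \<not> (\<exists>u v w. (u, v) \<in> parcs G \<and> (v, w) \<in> parcs G \<and> (w, u) \<in> parcs G)"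

text \<open>
  With unit weights, the cost of a walk is its length; the distance is \<open>\<infinity>\<close> if there is no walk.
\<close>

definition graph_dist :: "'a pair_pre_digraph \<Rightarrow> 'a \<Rightarrow> 'a \<Rightarrow> ereal" where
  "graph_dist G u v = wf_digraph.\<mu> (with_proj G) (\<lambda>_. 1) u v"

text \<open>The graph $G^{[\natural 2]}$.\<close>

definition exact_dist2 :: "'a pair_pre_digraph \<Rightarrow> 'a pair_pre_digraph" where
  "exact_dist2 G =
     \<lparr> pverts = pverts G,
       parcs = {(u, v). u \<in> pverts G \<and> v \<in> pverts G \<and> graph_dist G u v = 2} \<rparr>"

text \<open>The graph $G^{[[2]]}$; the vertices of a path are distinct, so its ends differ.\<close>

definition path2 :: "'a pair_pre_digraph \<Rightarrow> 'a pair_pre_digraph" where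
  "path2 G =
     \<lparr> pverts = pverts G,
       parcs = {(u, v). \<exists>p. pre_digraph.apath (with_proj G) u p v \<and> length p = 2} \<rparr>"

text \<open>The operation $\uplus$; it is only used for graphs with the same vertex set.\<close>

definition edge_union ::
    "'a pair_pre_digraph \<Rightarrow> 'a pair_pre_digraph \<Rightarrow> 'a pair_pre_digraph" where
  "edge_union G H = \<lparr> pverts = pverts G \<union> pverts H, parcs = parcs G \<union> parcs H \<rparr>"

definition direct_product ::
    "'a pair_pre_digraph \<Rightarrow> 'b pair_pre_digraph \<Rightarrow> ('a \<times> 'b) pair_pre_digraph" where
  "direct_product G H =
     \<lparr> pverts = pverts G \<times> pverts H,
       parcs = {((g1, h1), (g2, h2)). (g1, g2) \<in> parcs G \<and> (h1, h2) \<in> parcs H} \<rparr>"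

definition cartesian_product ::
    "'a pair_pre_digraph \<Rightarrow> 'b pair_pre_digraph \<Rightarrow> ('a \<times> 'b) pair_pre_digraph" where
  "cartesian_product G H =
     \<lparr> pverts = pverts G \<times> pverts H,
       parcs = {((g1, h1), (g2, h2)).
         (g1, h1) \<in> pverts G \<times> pverts H \<and> (g2, h2) \<in> pverts G \<times> pverts H \<and>
         ((g1, g2) \<in> parcs G \<and> h1 = h2 \<or> g1 = g2 \<and> (h1, h2) \<in> parcs H)} \<rparr>"

definition strong_product ::
    "'a pair_pre_digraph \<Rightarrow> 'b pair_pre_digraph \<Rightarrow> ('a \<times> 'b) pair_pre_digraph" where
  "strong_product G H =
     \<lparr> pverts = pverts G \<times> pverts H,
       parcs = {((g1, h1), (g2, h2)).
         (g1, h1) \<in> pverts G \<times> pverts H \<and> (g2, h2) \<in> pverts G \<times> pverts H \<and>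
         (g1, h1) \<noteq> (g2, h2) \<and>
         ((g1, g2) \<in> parcs G \<and> h1 = h2 \<or>
          g1 = g2 \<and> (h1, h2) \<in> parcs H \<or>
          (g1, g2) \<in> parcs G \<and> (h1, h2) \<in> parcs H)} \<rparr>"

end

theory Submission
  imports Defs
begin

text \<open>
  Two vertices are at distance 2 iff they are distinct, non-adjacent and have a common neighbour.
  In \<open>G \<times> H\<close> a common neighbour is a pair of common neighbours of the coordinates, and a vertex
  shares a neighbour with itself because it is not isolated. Hence distinct vertices with a common
  neighbour either agree in one coordinate (and are then non-adjacent, as there are no loops) or
  are joined by a path of length 2 in both coordinates, in which case non-adjacency in \<open>G \<times> H\<close>
  means non-adjacency in at least one coordinate. In a triangle-free graph
  \<open>G\<^bsup>[[2]]\<^esup> = G\<^bsup>[\<natural>2]\<^esup>\<close>.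
\<close>

context pair_wf_digraph
begin

lemma awalk_cost_unit: "awalk_cost (\<lambda>_. 1) p = length p"
  by (induction p) auto

text \<open>The distance is an infimum of walk lengths. These are natural numbers, so the value 2 is
  attained by a walk of two arcs, and any shorter walk would be empty or a single arc.\<close>

lemma graph_dist_eq_2_iff:
  "graph_dist G u v = 2 \<longleftrightarrow>
     u \<noteq> v \<and> (u, v) \<notin> parcs G \<and> (\<exists>w. (u, w) \<in> parcs G \<and> (w, v) \<in> parcs G)"
proof
  assume dist: "graph_dist G u v = 2"
  have ge: "2 \<le> length p" if "awalk u p v" for p
  proof -
    have "graph_dist G u v \<le> ereal (awalk_cost (\<lambda>_. 1) p)"
      unfolding graph_dist_def using that by (rule min_cost_le_walk_cost)
    then have "(2::ereal) \<le> ereal (real (length p))"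
      by (simp add: dist awalk_cost_unit)
    then have "ereal 2 \<le> ereal (real (length p))" by simp
    then show ?thesis unfolding ereal_less_eq by linarith
  qed
  \<comment> \<open>An infimum yields an actual walk only through a strict bound; below 3,
    \<open>ge\<close> leaves length exactly 2.\<close>
  have "(INF p\<in>{p. awalk u p v}. ereal (awalk_cost (\<lambda>_. 1) p)) < ereal 3"
    using dist unfolding graph_dist_def \<mu>_def by simp
  then obtain p where p: "awalk u p v" "length p < 3"
    by (auto simp: INF_less_iff awalk_cost_unit)
  with ge[of p] have "length p = 2" by simp
  then obtain e f where "p = [e, f]"
    by (auto simp: length_Suc_conv numeral_2_eq_2)
  with p have "\<exists>w. (u, w) \<in> parcs G \<and> (w, v) \<in> parcs G"
    by (cases e; cases f) (auto simp: awalk_simps)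
  \<comment> \<open>If \<open>u = v\<close>, the empty walk would violate \<open>ge\<close>; an arc
    from \<open>u\<close> to \<open>v\<close> would violate it as a walk of length 1.\<close>
  moreover have "u \<noteq> v"
    using ge[of "[]"] p(1) by (auto simp: awalk_Nil_iff awalk_hd_in_verts)
  moreover have "(u, v) \<notin> parcs G"
    using ge[of "[(u, v)]"] by (auto simp: awalk_simps in_arcsD2)
  ultimately show "u \<noteq> v \<and> (u, v) \<notin> parcs G \<and> (\<exists>w. (u, w) \<in> parcs G \<and> (w, v) \<in> parcs G)"
    by blast
next
  assume "u \<noteq> v \<and> (u, v) \<notin> parcs G \<and> (\<exists>w. (u, w) \<in> parcs G \<and> (w, v) \<in> parcs G)"
  then obtain w where neq: "u \<noteq> v" and nadj: "(u, v) \<notin> parcs G"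
    and w: "(u, w) \<in> parcs G" "(w, v) \<in> parcs G"
    by blast
  have ge: "2 \<le> length p" if "awalk u p v" for p
  \<comment> \<open>This rule is borrowed only for its case split: empty list, one element, at least
    two.\<close>
  proof (cases p rule: remdups_adj.cases)
    case 1
    with that neq show ?thesis by (simp add: awalk_simps)
  next
    case (2 e)
    with that nadj show ?thesis by (cases e) (auto simp: awalk_simps)
  next
    case 3
    then show ?thesis by simp
  qed
  have "awalk u [(u, w), (w, v)] v"
    using w by (auto simp: awalk_simps in_arcsD2)
  then have "graph_dist G u v \<le> ereal (awalk_cost (\<lambda>_. 1) [(u, w), (w, v)])"
    unfolding graph_dist_def by (rule min_cost_le_walk_cost)
  then have "graph_dist G u v \<le> 2" by simp
  moreover have "2 \<le> graph_dist G u v"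
    unfolding graph_dist_def \<mu>_def
  proof (rule INF_greatest)
    fix p assume "p \<in> {p. awalk u p v}"
    then have "ereal 2 \<le> ereal (real (length p))"
      unfolding ereal_less_eq using ge[of p] by simp
    then show "2 \<le> ereal (awalk_cost (\<lambda>_. 1) p)"
      by (simp add: awalk_cost_unit)
  qed
  ultimately show "graph_dist G u v = 2" by (rule antisym)
qed

lemma parcs_exact_dist2_iff:
  "(u, v) \<in> parcs (exact_dist2 G) \<longleftrightarrow>
     u \<noteq> v \<and> (u, v) \<notin> parcs G \<and> (\<exists>w. (u, w) \<in> parcs G \<and> (w, v) \<in> parcs G)"
  unfolding exact_dist2_def using graph_dist_eq_2_iff[of u v]
  by (auto dest: in_arcsD1 in_arcsD2)

end

text \<open>Without loops the middle vertex differs from both ends, so a walk of two arcs with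
  distinct ends is a path.\<close>

lemma (in pair_loopfree_digraph) parcs_path2_iff:
  "(u, v) \<in> parcs (path2 G) \<longleftrightarrow>
     u \<noteq> v \<and> (\<exists>w. (u, w) \<in> parcs G \<and> (w, v) \<in> parcs G)"
proof
  assume "(u, v) \<in> parcs (path2 G)"
  then obtain p where "apath u p v" "length p = 2"
    by (auto simp: path2_def)
  moreover from this obtain e f where "p = [e, f]"
    by (auto simp: length_Suc_conv numeral_2_eq_2)
  ultimately show "u \<noteq> v \<and> (\<exists>w. (u, w) \<in> parcs G \<and> (w, v) \<in> parcs G)"
    by (cases e; cases f) (auto simp: apath_simps)
next
  assume "u \<noteq> v \<and> (\<exists>w. (u, w) \<in> parcs G \<and> (w, v) \<in> parcs G)"
  then obtain w where "u \<noteq> v" "(u, w) \<in> parcs G" "(w, v) \<in> parcs G"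
    by blast
  then have "apath u [(u, w), (w, v)] v"
    by (auto simp: apath_simps in_arcsD2 dest: pair_no_loops)
  then show "(u, v) \<in> parcs (path2 G)"
    by (fastforce simp: path2_def)
qed

lemma pverts_exact_dist2 [simp]: "pverts (exact_dist2 G) = pverts G"
  by (simp add: exact_dist2_def)

lemma pverts_path2 [simp]: "pverts (path2 G) = pverts G"
  by (simp add: path2_def)

text \<open>Adjacent vertices with a common neighbour would form a triangle; symmetry of the arcs
  turns it into a directed 3-cycle.\<close>

lemma (in pair_bidirected_digraph) path2_eq_exact_dist2:
  assumes "triangle_free G"
  shows "path2 G = exact_dist2 G"
proof -
  have "(u, v) \<in> parcs (path2 G) \<longleftrightarrow> (u, v) \<in> parcs (exact_dist2 G)" for u v
    unfolding parcs_path2_iff parcs_exact_dist2_iff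
    using assms arcs_symmetric unfolding triangle_free_def by blast
  then have "parcs (path2 G) = parcs (exact_dist2 G)" by auto
  then show ?thesis by (simp add: pair_pre_digraph.equality)
qed

text \<open>Makes the characterisation of distance 2 available in the product.\<close>

lemma pair_wf_digraph_direct_product:
  assumes "pair_wf_digraph G" "pair_wf_digraph H"
  shows "pair_wf_digraph (direct_product G H)"
  using assms by (fastforce simp: pair_wf_digraph_def direct_product_def)

lemma common_neighbour_self:
  assumes "simple_graph G" "\<not> (\<exists>v. isolated_vertex G v)" "v \<in> pverts G"
  shows "\<exists>w. (v, w) \<in> parcs G \<and> (w, v) \<in> parcs G"
proof -
  interpret pair_bidirected_digraph G by fact
  show ?thesis using assms arcs_symmetric by (fastforce simp: isolated_vertex_def)
qed

lemma exact_dist2_direct_product: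
  assumes "simple_graph G" "simple_graph H"
    and "\<not> (\<exists>v. isolated_vertex G v)" "\<not> (\<exists>v. isolated_vertex H v)"
  shows "exact_dist2 (direct_product G H) =
           edge_union
             (edge_union
               (cartesian_product (path2 G) (path2 H))
               (direct_product (path2 G) (exact_dist2 H)))
             (direct_product (exact_dist2 G) (path2 H))" (is "?L = ?R")
proof -
  interpret G: pair_bidirected_digraph G by fact
  interpret H: pair_bidirected_digraph H by fact
  interpret GH: pair_wf_digraph "direct_product G H"
    by (intro pair_wf_digraph_direct_product G.pair_wf_digraph_axioms H.pair_wf_digraph_axioms)
  have "((g1, h1), (g2, h2)) \<in> parcs ?L \<longleftrightarrow> ((g1, h1), (g2, h2)) \<in> parcs ?R" for g1 h1 g2 h2
  proof -
    have L: "((g1, h1), (g2, h2)) \<in> parcs ?L \<longleftrightarrow>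
        (g1, h1) \<noteq> (g2, h2) \<and> \<not> ((g1, g2) \<in> parcs G \<and> (h1, h2) \<in> parcs H) \<and>
        (\<exists>w. (g1, w) \<in> parcs G \<and> (w, g2) \<in> parcs G) \<and>
        (\<exists>w. (h1, w) \<in> parcs H \<and> (w, h2) \<in> parcs H)"
      unfolding GH.parcs_exact_dist2_iff by (auto simp: direct_product_def)
    have R: "((g1, h1), (g2, h2)) \<in> parcs ?R \<longleftrightarrow>
        g1 \<in> pverts G \<and> h1 \<in> pverts H \<and> g2 \<in> pverts G \<and> h2 \<in> pverts H \<and>
          ((g1, g2) \<in> parcs (path2 G) \<and> h1 = h2 \<or> g1 = g2 \<and> (h1, h2) \<in> parcs (path2 H)) \<or>
        (g1, g2) \<in> parcs (path2 G) \<and> (h1, h2) \<in> parcs (exact_dist2 H) \<or>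
        (g1, g2) \<in> parcs (exact_dist2 G) \<and> (h1, h2) \<in> parcs (path2 H)"
      by (auto simp: edge_union_def cartesian_product_def direct_product_def)
    \<comment> \<open>Split by which coordinates agree. Where one agrees,
      \<open>common_neighbour_self\<close> supplies its common neighbour and
      \<open>pair_no_loops\<close> the non-adjacency, which gives the Cartesian term; where both
      differ, non-adjacency in one coordinate selects a direct product.\<close>
    show ?thesis
      unfolding L R G.parcs_path2_iff H.parcs_path2_iff
        G.parcs_exact_dist2_iff H.parcs_exact_dist2_iff
      using common_neighbour_self[OF assms(1,3), of g1] common_neighbour_self[OF assms(2,4), of h1]
        G.pair_no_loops[of "(g1, g2)"] H.pair_no_loops[of "(h1, h2)"]
      by (auto dest: G.in_arcsD1 G.in_arcsD2 H.in_arcsD1 H.in_arcsD2)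
  qed
  then have "parcs ?L = parcs ?R" by auto
  moreover have "pverts ?L = pverts ?R"
    by (simp add: edge_union_def cartesian_product_def direct_product_def)
  ultimately show ?thesis by (simp add: pair_pre_digraph.equality)
qed

text \<open>Loop-freeness forces the ends of every arc on the right to be distinct, and
  well-formedness puts the ends of direct-product arcs into the vertex set.\<close>

lemma strong_product_eq_edge_union:
  assumes "pair_loopfree_digraph G" "pair_loopfree_digraph H"
  shows "strong_product G H = edge_union (cartesian_product G H) (direct_product G H)"
proof -
  interpret G: pair_loopfree_digraph G by fact
  interpret H: pair_loopfree_digraph H by fact
  show ?thesis
    by (auto simp: strong_product_def edge_union_def cartesian_product_def direct_product_def
        dest: G.in_arcsD1 G.in_arcsD2 H.in_arcsD1 H.in_arcsD2 G.pair_no_loops H.pair_no_loops)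
qed

lemma (in pair_wf_digraph) pair_loopfree_digraph_exact_dist2:
  "pair_loopfree_digraph (exact_dist2 G)"
proof
  fix e assume e: "e \<in> parcs (exact_dist2 G)"
  then show "fst e \<in> pverts (exact_dist2 G)" "snd e \<in> pverts (exact_dist2 G)"
    by (auto simp: exact_dist2_def)
  from e show "fst e \<noteq> snd e" by (cases e) (simp add: parcs_exact_dist2_iff)
qed

theorem theorem2p4:
  fixes G :: "'a pair_pre_digraph" and H :: "'b pair_pre_digraph"
  assumes "simple_graph G" and "simple_graph H"
    and "\<not> (\<exists>v. isolated_vertex G v)" and "\<not> (\<exists>v. isolated_vertex H v)"
  shows "exact_dist2 (direct_product G H) =
           edge_union
             (edge_union
               (cartesian_product (path2 G) (path2 H))
               (direct_product (path2 G) (exact_dist2 H)))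
             (direct_product (exact_dist2 G) (path2 H))
         \<and> (triangle_free G \<and> triangle_free H \<longrightarrow>
              exact_dist2 (direct_product G H) =
                strong_product (exact_dist2 G) (exact_dist2 H))"
proof -
  interpret G: pair_bidirected_digraph G by fact
  interpret H: pair_bidirected_digraph H by fact
  \<comment> \<open>For triangle-free graphs each \<open>path2\<close> becomes
    \<open>exact_dist2\<close>, so both direct products coincide and the union collapses to
    Cartesian plus direct, which is the strong product.\<close>
  show ?thesis
    using exact_dist2_direct_product[OF assms]
    by (auto simp: G.path2_eq_exact_dist2 H.path2_eq_exact_dist2 edge_union_def
        strong_product_eq_edge_union G.pair_loopfree_digraph_exact_dist2
        H.pair_loopfree_digraph_exact_dist2)
qed

end
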